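(* Let $S$ be a semiring such that each minimal prime ideal of $S$ is subtractive. Let $f = \sum_{i=0}^{\infty} f_i X^i$ and $g = \sum_{j=0}^{\infty} g_j X^j$ be elements of $S[[X]]$ such that $fg = 0$. Then $A_f A_g \subseteq \mathrm{Nil}(S)$.
   Context: A semiring is a set $S$ with operations $+,\cdot$ such that $(S,+,0)$ and $(S,\cdot,1)$ are commutative monoids with $1\neq 0$, multiplication distributes over addition, and $s\cdot 0=0$ for all $s$. An ideal of $S$ is a nonempty subset closed under addition and under multiplication by elements of $S$. A proper ideal $\mathfrak p$ is prime if $ab\in\mathfrak p$ implies $a\in\mathfrak p$ or $b\in\mathfrak p$. An ideal $I$ is subtractive if $a+b\in I$ and $a\in I$ imply $b\in I$, for all $a,b\in S$. $\mathrm{Nil}(S)$ is the set of nilpotent elements of $S$. $S[[X]]$ is the semiring of formal power series over $S$. For $f\in S[[X]]$, $A_f$ is the ideal of $S$ generated by all coefficients of $f$. $A_fA_g$ is the usual product of ideals (finite sums of products). *)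

theory Defs
  imports "HOL-Computational_Algebra.Formal_Power_Series"
begin

text \<open>
  Semirings here are commutative, with \<open>s * 0 = 0\<close> and \<open>0 \<noteq> 1\<close>; this is precisely the class
  \<^class>\<open>comm_semiring_1\<close>. Additive cancellation is not assumed.
\<close>

definition semiring_ideal :: "'a::comm_semiring_1 set \<Rightarrow> bool" where
  "semiring_ideal I \<longleftrightarrow>
     I \<noteq> {} \<and> (\<forall>a\<in>I. \<forall>b\<in>I. a + b \<in> I) \<and> (\<forall>s. \<forall>a\<in>I. s * a \<in> I)"

definition prime_semiring_ideal :: "'a::comm_semiring_1 set \<Rightarrow> bool" where
  "prime_semiring_ideal P \<longleftrightarrow>
     semiring_ideal P \<and> P \<noteq> UNIV \<and> (\<forall>a b. a * b \<in> P \<longrightarrow> a \<in> P \<or> b \<in> P)"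

definition minimal_prime_semiring_ideal :: "'a::comm_semiring_1 set \<Rightarrow> bool" where
  "minimal_prime_semiring_ideal P \<longleftrightarrow>
     prime_semiring_ideal P \<and> (\<forall>Q. prime_semiring_ideal Q \<and> Q \<subseteq> P \<longrightarrow> Q = P)"

definition subtractive :: "'a::comm_semiring_1 set \<Rightarrow> bool" where
  "subtractive I \<longleftrightarrow> (\<forall>a b. a + b \<in> I \<and> a \<in> I \<longrightarrow> b \<in> I)"

definition nilpotents :: "'a::comm_semiring_1 set" where
  "nilpotents = {s. \<exists>n>0. s ^ n = 0}"

definition content_ideal :: "'a::comm_semiring_1 fps \<Rightarrow> 'a set" where
  "content_ideal f = semiring_ideal hull range (fps_nth f)"

definition semiring_ideal_prod :: "'a::comm_semiring_1 set \<Rightarrow> 'a set \<Rightarrow> 'a set" where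
  "semiring_ideal_prod I J =
     {\<Sum>k<n. a k * b k | (n::nat) a b. (\<forall>k<n. a k \<in> I \<and> b k \<in> J)}"

end

theory Submission
  imports Defs
begin

text \<open>
  If \<open>x\<close> is not nilpotent, the complement \<open>P\<close> of a multiplicative set that contains \<open>x\<close> and is
  maximal among those avoiding \<open>0\<close> is a minimal prime ideal with \<open>x \<notin> P\<close>, and it is subtractive
  by hypothesis. If neither \<open>f\<close> nor \<open>g\<close> had all its coefficients in \<open>P\<close>, take the first
  coefficients \<open>f\<^sub>i\<close>, \<open>g\<^sub>j\<close> outside \<open>P\<close>: in the vanishing coefficient of index \<open>i + j\<close> of \<open>f * g\<close>
  every term other than \<open>f\<^sub>i * g\<^sub>j\<close> lies in \<open>P\<close>, so subtractivity puts \<open>f\<^sub>i * g\<^sub>j\<close> in \<open>P\<close>, against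
  primality. Hence \<open>P\<close> contains the product of the two content ideals, while \<open>x \<notin> P\<close>.
\<close>

lemma semiring_ideal_zero: "semiring_ideal I \<Longrightarrow> 0 \<in> I"
  unfolding semiring_ideal_def by (metis ex_in_conv mult_zero_left)

lemma semiring_ideal_add: "semiring_ideal I \<Longrightarrow> a \<in> I \<Longrightarrow> b \<in> I \<Longrightarrow> a + b \<in> I"
  unfolding semiring_ideal_def by blast

lemma semiring_ideal_mult_left: "semiring_ideal I \<Longrightarrow> a \<in> I \<Longrightarrow> s * a \<in> I"
  unfolding semiring_ideal_def by blast

lemma semiring_ideal_mult_right: "semiring_ideal I \<Longrightarrow> a \<in> I \<Longrightarrow> a * s \<in> I"
  by (metis semiring_ideal_mult_left mult.commute)

lemma semiring_ideal_sum:
  assumes "semiring_ideal I" "\<And>k. k \<in> A \<Longrightarrow> h k \<in> I"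
  shows "sum h A \<in> I"
  using assms(2)
  by (induction A rule: infinite_finite_induct)
    (auto intro: semiring_ideal_zero semiring_ideal_add assms(1))

lemma semiring_ideal_prod_subset:
  assumes "semiring_ideal P" "I \<subseteq> P \<or> J \<subseteq> P"
  shows "semiring_ideal_prod I J \<subseteq> P"
  using assms unfolding semiring_ideal_prod_def
  by (auto intro!: semiring_ideal_sum intro: semiring_ideal_mult_left semiring_ideal_mult_right)

text \<open>Prime ideals have complements of this kind, and inclusion reverses under complement, so
  maximal such sets are the candidates for complements of minimal primes.\<close>

definition zero_free_multiplicative :: "'a::comm_semiring_1 set \<Rightarrow> bool" where
  "zero_free_multiplicative M \<longleftrightarrow> 1 \<in> M \<and> 0 \<notin> M \<and> (\<forall>a\<in>M. \<forall>b\<in>M. a * b \<in> M)"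

lemma zero_free_multiplicative_power:
  "zero_free_multiplicative M \<Longrightarrow> a \<in> M \<Longrightarrow> a ^ n \<in> M"
  by (induction n) (auto simp: zero_free_multiplicative_def)

lemma zero_free_multiplicative_compl_prime:
  "prime_semiring_ideal Q \<Longrightarrow> zero_free_multiplicative (- Q)"
  unfolding prime_semiring_ideal_def zero_free_multiplicative_def
  by (metis ComplD ComplI UNIV_eq_I mult.right_neutral semiring_ideal_mult_left semiring_ideal_zero)

text \<open>The products \<open>m * a ^ n\<close> with \<open>m\<close> in \<open>M\<close> form a
  multiplicative set containing both \<open>M\<close> and \<open>a\<close>. If it avoided 0,
  maximality would make it equal to \<open>M\<close>, forcing \<open>a\<close> into
  \<open>M\<close>.\<close>

lemma maximal_zero_free_multiplicative_annihilator:
  fixes M :: "'a::comm_semiring_1 set"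
  assumes M: "zero_free_multiplicative M"
    and max: "\<And>N. zero_free_multiplicative N \<Longrightarrow> M \<subseteq> N \<Longrightarrow> N = M"
    and a: "a \<notin> M"
  obtains m n where "m \<in> M" "m * a ^ n = 0"
proof (rule ccontr)
  assume "\<not> thesis"
  with that have nz: "m * a ^ n \<noteq> 0" if "m \<in> M" for m n
    using \<open>m \<in> M\<close> by blast
  define N where "N = {m * a ^ n | m n. m \<in> M}"
  have N_mult: "b * c \<in> N" if bc: "b \<in> N" "c \<in> N" for b c
  proof -
    from bc obtain m n m' n' where
      *: "m \<in> M" "m' \<in> M" "b = m * a ^ n" "c = m' * a ^ n'"
      unfolding N_def by blast
    then have "b * c = (m * m') * a ^ (n + n')"
      by (simp add: power_add ac_simps)
    moreover have "m * m' \<in> M"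
      using M * by (auto simp: zero_free_multiplicative_def)
    ultimately show ?thesis
      unfolding N_def by blast
  qed
  have MN: "M \<subseteq> N"
  proof
    fix m assume "m \<in> M"
    moreover have "m = m * a ^ 0" by simp
    ultimately show "m \<in> N" unfolding N_def by blast
  qed
  have one: "1 \<in> M"
    using M by (simp add: zero_free_multiplicative_def)
  have "0 \<notin> N"
    using nz unfolding N_def by force
  with N_mult MN one have "zero_free_multiplicative N"
    unfolding zero_free_multiplicative_def by blast
  with max MN have "N = M" by blast
  moreover have "a = 1 * a ^ 1" by simp
  then have "a \<in> N"
    unfolding N_def using one by blast
  ultimately show False
    using a by blast
qed

text \<open>By maximality, \<open>a\<close> lies outside \<open>M\<close> exactly when some element
  of \<open>M\<close> annihilates a power of \<open>a\<close>. This criterion turns closure of the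
  complement under addition and under multiples into computations with annihilators, free of
  subtraction.\<close>

lemma minimal_prime_compl_maximal_zero_free_multiplicative:
  fixes M :: "'a::comm_semiring_1 set"
  assumes M: "zero_free_multiplicative M"
    and max: "\<And>N. zero_free_multiplicative N \<Longrightarrow> M \<subseteq> N \<Longrightarrow> N = M"
  shows "minimal_prime_semiring_ideal (- M)"
proof -
  note annihilator = maximal_zero_free_multiplicative_annihilator[OF M max]
  \<comment> \<open>Converse of \<open>annihilator\<close>: if \<open>a\<close> were in
    \<open>M\<close>, then so would be \<open>m * a ^ n\<close>, which is 0.\<close>
  have not_mem: "a \<notin> M" if "m \<in> M" "m * a ^ n = 0" for a m n
    using that M zero_free_multiplicative_power[OF M]
    unfolding zero_free_multiplicative_def by metis
  have add: "a + b \<notin> M" if ab: "a \<notin> M" "b \<notin> M" for a b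
  proof -
    obtain m n where m: "m \<in> M" "m * a ^ n = 0"
      using annihilator ab(1) by blast
    obtain m' k where m': "m' \<in> M" "m' * b ^ k = 0"
      using annihilator ab(2) by blast
    \<comment> \<open>These are the terms of \<open>m * m' * (a + b) ^ (n + k)\<close>. Either the
      exponent of \<open>a\<close> is at least \<open>n\<close>, and \<open>m\<close> kills the
      term, or the exponent of \<open>b\<close> exceeds \<open>k\<close>, and \<open>m'\<close>
      does.\<close>
    let ?t = "\<lambda>i. m * m' * (of_nat (n + k choose i) * a ^ i * b ^ (n + k - i))"
    have "?t i = 0" for i
    proof (cases "n \<le> i")
      case True
      then have "m * a ^ i = (m * a ^ n) * a ^ (i - n)"
        by (metis le_add_diff_inverse mult.assoc power_add)
      then have "m * a ^ i = 0" using m by simp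
      moreover have "?t i = (m * a ^ i) * (m' * (of_nat (n + k choose i) * b ^ (n + k - i)))"
        by (simp add: ac_simps)
      ultimately show ?thesis by simp
    next
      case False
      then have "n + k - i = k + (n - i)" by simp
      then have "m' * b ^ (n + k - i) = (m' * b ^ k) * b ^ (n - i)"
        by (metis mult.assoc power_add)
      then have "m' * b ^ (n + k - i) = 0" using m' by simp
      moreover have "?t i = (m' * b ^ (n + k - i)) * (m * (of_nat (n + k choose i) * a ^ i))"
        by (simp add: ac_simps)
      ultimately show ?thesis by simp
    qed
    then have "m * m' * (a + b) ^ (n + k) = 0"
      by (simp add: binomial_ring sum_distrib_left)
    moreover have "m * m' \<in> M"
      using M m m' by (auto simp: zero_free_multiplicative_def)
    ultimately show ?thesis
      using not_mem by blast
  qed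
  have mult: "s * a \<notin> M" if a: "a \<notin> M" for s a
  proof -
    obtain m n where m: "m \<in> M" "m * a ^ n = 0"
      using annihilator a by blast
    have "m * (s * a) ^ n = s ^ n * (m * a ^ n)"
      by (simp add: power_mult_distrib ac_simps)
    also have "\<dots> = 0"
      using m by simp
    finally show ?thesis
      using not_mem m by blast
  qed
  have "prime_semiring_ideal (- M)"
    using M add mult
    unfolding prime_semiring_ideal_def semiring_ideal_def zero_free_multiplicative_def by blast
  \<comment> \<open>Minimality: the complement of a prime inside \<open>- M\<close> is a zero-free
    multiplicative set containing \<open>M\<close>, hence equals \<open>M\<close>.\<close>
  moreover have "Q = - M" if "prime_semiring_ideal Q" "Q \<subseteq> - M" for Q
    using max[OF zero_free_multiplicative_compl_prime[OF that(1)]] that(2) by blast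
  ultimately show ?thesis
    unfolding minimal_prime_semiring_ideal_def by blast
qed

lemma non_nilpotent_minimal_prime:
  fixes x :: "'a::comm_semiring_1"
  assumes "x \<notin> nilpotents"
  obtains P where "minimal_prime_semiring_ideal P" "x \<notin> P"
proof -
  let ?\<M> = "{M. zero_free_multiplicative M \<and> x \<in> M}"
  \<comment> \<open>\<open>nilpotents\<close> speaks of positive exponents only; for exponent 0 the
    claim is \<open>1 \<noteq> 0\<close>.\<close>
  have "x ^ n \<noteq> 0" for n
    using assms by (cases n) (auto simp: nilpotents_def)
  moreover have "x ^ 0 \<in> range ((^) x)" "x ^ 1 \<in> range ((^) x)"
    by blast+
  ultimately have "range ((^) x) \<in> ?\<M>"
    by (auto simp: zero_free_multiplicative_def simp flip: power_add)
  then have "?\<M> \<noteq> {}" by blast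
  moreover have "\<Union>\<C> \<in> ?\<M>" if "\<C> \<noteq> {}" and chain: "subset.chain ?\<M> \<C>" for \<C>
  proof -
    have C: "zero_free_multiplicative M" "x \<in> M" if "M \<in> \<C>" for M
      using chain that by (auto simp: subset.chain_def)
    have "a * b \<in> \<Union>\<C>" if ab: "a \<in> \<Union>\<C>" "b \<in> \<Union>\<C>" for a b
    proof -
      from ab obtain A B where AB: "A \<in> \<C>" "B \<in> \<C>" "a \<in> A" "b \<in> B"
        by blast
      \<comment> \<open>The larger of the two chain members contains both factors, hence their
        product.\<close>
      moreover have "A \<subseteq> B \<or> B \<subseteq> A"
        using chain AB by (auto simp: subset_chain_def)
      ultimately show ?thesis
        using C unfolding zero_free_multiplicative_def by blast
    qed
    with C \<open>\<C> \<noteq> {}\<close> show ?thesis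
      unfolding zero_free_multiplicative_def by blast
  qed
  ultimately have "\<exists>M\<in>?\<M>. \<forall>N\<in>?\<M>. M \<subseteq> N \<longrightarrow> N = M"
    by (rule subset_Zorn_nonempty)
  then obtain M where M: "M \<in> ?\<M>" and max: "\<And>N. N \<in> ?\<M> \<Longrightarrow> M \<subseteq> N \<Longrightarrow> N = M"
    by blast
  \<comment> \<open>Zorn gives maximality only among sets containing \<open>x\<close>, but every
    superset of \<open>M\<close> contains \<open>x\<close>, so \<open>M\<close> is maximal among all
    zero-free multiplicative sets.\<close>
  have "minimal_prime_semiring_ideal (- M)"
    using M max by (intro minimal_prime_compl_maximal_zero_free_multiplicative) blast+
  with M that show ?thesis by blast
qed

lemma subtractive_prime_fps_mult_eq_0:
  fixes f g :: "'a::comm_semiring_1 fps"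
  assumes P: "prime_semiring_ideal P" and sub: "subtractive P" and fg: "f * g = 0"
  shows "range (fps_nth f) \<subseteq> P \<or> range (fps_nth g) \<subseteq> P"
proof (rule ccontr)
  assume "\<not> ?thesis"
  then have ex: "\<exists>i. fps_nth f i \<notin> P" "\<exists>j. fps_nth g j \<notin> P"
    by auto
  define i where "i = (LEAST i. fps_nth f i \<notin> P)"
  define j where "j = (LEAST j. fps_nth g j \<notin> P)"
  have i: "fps_nth f i \<notin> P" "\<And>k. k < i \<Longrightarrow> fps_nth f k \<in> P"
    using LeastI_ex[OF ex(1)] not_less_Least unfolding i_def by blast+
  have j: "fps_nth g j \<notin> P" "\<And>k. k < j \<Longrightarrow> fps_nth g k \<in> P"
    using LeastI_ex[OF ex(2)] not_less_Least unfolding j_def by blast+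
  have I: "semiring_ideal P"
    using P by (simp add: prime_semiring_ideal_def)
  let ?t = "\<lambda>k. fps_nth f k * fps_nth g (i + j - k)"
  have rest: "sum ?t ({0..i + j} - {i}) \<in> P"
  proof (rule semiring_ideal_sum[OF I])
    fix k assume "k \<in> {0..i + j} - {i}"
    \<comment> \<open>Past \<open>i\<close>, the complementary index \<open>i + j - k\<close> drops
      below \<open>j\<close>, so one of the two factors always precedes the first coefficient
      outside \<open>P\<close>.\<close>
    then consider "k < i" | "i + j - k < j" by force
    then show "?t k \<in> P"
      by cases (auto intro: i j semiring_ideal_mult_left[OF I] semiring_ideal_mult_right[OF I])
  qed
  have "sum ?t ({0..i + j} - {i}) + ?t i = fps_nth (f * g) (i + j)"
    by (simp add: fps_mult_nth sum.remove[of "{0..i + j}" i] add.commute)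
  also have "\<dots> \<in> P"
    using semiring_ideal_zero[OF I] fg by simp
  finally have "?t i \<in> P"
    using sub rest unfolding subtractive_def by blast
  then show False
    using P i(1) j(1) by (auto simp: prime_semiring_ideal_def)
qed

theorem proposition4p3:
  fixes f g :: "'a::comm_semiring_1 fps"
  assumes "\<And>P :: 'a set. minimal_prime_semiring_ideal P \<Longrightarrow> subtractive P"
    and "f * g = 0"
  shows "semiring_ideal_prod (content_ideal f) (content_ideal g) \<subseteq> nilpotents"
proof
  fix x assume x: "x \<in> semiring_ideal_prod (content_ideal f) (content_ideal g)"
  show "x \<in> nilpotents"
  proof (rule ccontr)
    assume "x \<notin> nilpotents"
    then obtain P where P: "minimal_prime_semiring_ideal P" "x \<notin> P"
      by (rule non_nilpotent_minimal_prime)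
    then have prime: "prime_semiring_ideal P" and I: "semiring_ideal P"
      by (auto simp: minimal_prime_semiring_ideal_def prime_semiring_ideal_def)
    \<comment> \<open>A content ideal is a hull, so an ideal that contains all coefficients contains
      it.\<close>
    have "content_ideal f \<subseteq> P \<or> content_ideal g \<subseteq> P"
      using subtractive_prime_fps_mult_eq_0[OF prime assms(1)[OF P(1)] assms(2)] I
      unfolding content_ideal_def by (metis hull_minimal)
    then show False
      using semiring_ideal_prod_subset[OF I] x P(2) by blast
  qed
qed

end
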